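(* Let $\mathcal C$ be a binary linear block code of length $n$ used with BPSK over an AWGN channel with noise variance $\sigma^2>0$ per component, let $d\ge1$ and $0\le d^*\le n$ be integers, and let $A_d\ge1$ be the number of codewords of Hamming weight $d$. If $A_d$ is even, $$\Pr\{E_d,\ W_H(\hat{\underline y})\le d^*\}\le A_d\Big(Q(\sqrt d/\sigma)-\tfrac12Q^2(\sqrt d/\sigma)\Big)B(p_b,n-2d,0,d^*-1);$$ if $A_d$ is odd, $$\Pr\{E_d,\ W_H(\hat{\underline y})\le d^*\}\le (A_d-1)\Big(Q(\sqrt d/\sigma)-\tfrac12Q^2(\sqrt d/\sigma)\Big)B(p_b,n-2d,0,d^*-1)+Q(\sqrt d/\sigma)\,B(p_b,n-d,0,d^*-1).$$
   Context: Channel: codewords are mapped by $\phi:\mathbb F_2^n\to\{-1,+1\}^n$, $\phi(\underline v)_t=1-2v_t$. The all-zero codeword $\underline c^{(0)}$ is transmitted; the received vector is $\underline y=\phi(\underline c^{(0)})+\underline z$, with $\underline z$ having i.i.d. $\mathcal N(0,\sigma^2)$ components. $E_d$ is the event that at least one codeword of Hamming weight $d$ has its image under $\phi$ nearer to $\underline y$ (in Euclidean distance) than $\phi(\underline c^{(0)})$. The hard-decision vector $\hat{\underline y}\in\mathbb F_2^n$ is given by $\hat y_t=0$ if $y_t>0$ and $\hat y_t=1$ if $y_t\le0$; $W_H$ is Hamming weight. The left-hand sides are probabilities that both listed events occur. Notation: $Q(x)=\int_x^{\infty}\frac1{\sqrt{2\pi}}e^{-z^2/2}\,dz$; $p_b=Q(1/\sigma)$;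 $B(p,N_t,N_\ell,N_u)=\sum_{m=N_\ell}^{N_u}\binom{N_t}{m}p^m(1-p)^{N_t-m}$, i.e. the probability that the number of bit errors in a binary vector of total length $N_t$, passed through a binary symmetric channel with crossover probability $p$, ranges from $N_\ell$ to $N_u$ (an empty sum is $0$).
   Formalization: When 2d > n the length n−2d in B is negative and the displayed formula is meaningless (or the bound false); there the formal statement reads the length as 0, so B = 1 for d* ≥ 1 and 0 for d* = 0. *)

theory Defs
  imports "HOL-Probability.Probability" "HOL-Library.Z2"
begin

definition hamming_weight :: "bit ^ 'n \<Rightarrow> nat" where
  "hamming_weight v = card {t. v $ t \<noteq> 0}"

definition bpsk :: "bit ^ 'n \<Rightarrow> real ^ 'n" where
  "bpsk v = (\<chi> t. 1 - 2 * of_bool (v $ t = 1))"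

definition hard_decision :: "real ^ 'n \<Rightarrow> bit ^ 'n" where
  "hard_decision y = (\<chi> t. if y $ t > 0 then 0 else 1)"

definition weight_codewords :: "(bit ^ 'n) set \<Rightarrow> nat \<Rightarrow> (bit ^ 'n) set" where
  "weight_codewords C d = {c \<in> C. hamming_weight c = d}"

definition weight_error :: "(bit ^ 'n) set \<Rightarrow> nat \<Rightarrow> real ^ 'n \<Rightarrow> bool" where
  "weight_error C d y \<longleftrightarrow>
     (\<exists>c \<in> weight_codewords C d. dist y (bpsk c) < dist y (bpsk 0))"

definition awgn :: "'a measure \<Rightarrow> real \<Rightarrow> ('a \<Rightarrow> real ^ 'n) \<Rightarrow> bool" where
  "awgn M \<sigma> z \<longleftrightarrow>
     prob_space.indep_vars M (\<lambda>_. borel) (\<lambda>t \<omega>. z \<omega> $ t) UNIV \<and>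
     (\<forall>t. distributed M lborel (\<lambda>\<omega>. z \<omega> $ t) (normal_density 0 \<sigma>))"

definition gaussian_Q :: "real \<Rightarrow> real" where
  "gaussian_Q x = (LINT z:{x..}|lborel. std_normal_density z)"

text \<open>
  Probability that a binary symmetric channel with crossover probability \<open>p\<close> makes between \<open>N\<^sub>l\<close>
  and \<open>N\<^sub>u\<close> errors in \<open>N\<^sub>t\<close> bits. The arguments are integers so that an upper limit of \<open>-1\<close> gives an
  empty sum. A negative length, which arises as \<open>n - 2d\<close> when \<open>2d > n\<close>, is read as length \<open>0\<close>
  (no bits remain, hence no errors).
\<close>

definition bsc_range_prob :: "real \<Rightarrow> int \<Rightarrow> int \<Rightarrow> int \<Rightarrow> real" where
  "bsc_range_prob p N\<^sub>t N\<^sub>l N\<^sub>u =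
     (\<Sum>m | N\<^sub>l \<le> int m \<and> int m \<le> N\<^sub>u.
        real (nat N\<^sub>t choose m) * p ^ m * (1 - p) ^ (nat N\<^sub>t - m))"

end

theory Submission
  imports Defs
begin

text \<open>
  A codeword \<open>c\<close> with support \<open>S\<close> beats the zero codeword iff \<open>\<Sum>t\<in>S. y\<^sub>t < 0\<close>, which forces a
  hard-decision error inside \<open>S\<close>; hence at most \<open>d\<^sup>* - 1\<close> errors remain for the coordinates outside
  \<open>S\<close>, and these are independent of the event. For two codewords the sums over their supports
  share a summand and are otherwise independent, so conditionally on the shared part Chebyshev's
  integral inequality shows that the two events are positively correlated, and their union has
  probability at most \<open>2q - q\<^sup>2\<close>. Enlarging the union of the two supports to a set of exactly
  \<open>min n (2d)\<close> coordinates leaves \<open>max 0 (n - 2d)\<close> outside. Splitting the codewords of weight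
  \<open>d\<close> into pairs, with one left over if their number is odd, and a union bound give the claim.
\<close>

section \<open>Positive correlation of partial sums of independent variables\<close>

text \<open>With \<open>m\<close> the mean of \<open>g\<close>, some constant \<open>c\<close> makes
  \<open>(f x - c) * (g x - m)\<close> nonnegative everywhere. Integrating this suffices, because
  \<open>g - m\<close> has mean zero and so the terms in \<open>c\<close> cancel. No product space
  is needed.\<close>

lemma (in prob_space) chebyshev_integral_inequality:
  fixes f g :: "'a \<Rightarrow> real"
  assumes f: "integrable M f" and g: "integrable M g" and fg: "integrable M (\<lambda>x. f x * g x)"
    and bdd: "bdd_above (range f)" "bdd_below (range f)"
    and mono: "\<And>x y. g x < g y \<Longrightarrow> f x \<le> f y"
  shows "expectation f * expectation g \<le> expectation (\<lambda>x. f x * g x)"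
proof -
  define m where "m = expectation g"
  have "\<exists>c. \<forall>x. 0 \<le> (f x - c) * (g x - m)"
  proof (cases "\<exists>x. g x < m")
    case True
    \<comment> \<open>By \<open>mono\<close>, this supremum separates the values of \<open>f\<close>
      on \<open>g x < m\<close> from those on \<open>m \<le> g x\<close>, so both factors always
      agree in sign.\<close>
    define c where "c = Sup (f ` {x. g x < m})"
    have bdd': "bdd_above (f ` {x. g x < m})"
      using bdd(1) by (rule bdd_above_mono) auto
    have "f x \<le> c" if "g x < m" for x
      unfolding c_def using that bdd' by (intro cSup_upper) auto
    moreover have "c \<le> f x" if "m \<le> g x" for x
      unfolding c_def using that True
      by (intro cSup_least) (auto intro!: mono)
    ultimately have "0 \<le> (f x - c) * (g x - m)" for x
      by (cases "g x < m") (auto simp: mult_nonpos_nonpos)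
    then show ?thesis by blast
  next
    case False
    \<comment> \<open>If \<open>g\<close> never falls below its mean, any lower bound of
      \<open>f\<close> serves as \<open>c\<close>.\<close>
    obtain c where "\<And>x. c \<le> f x"
      using bdd(2) by (auto simp: bdd_below_def)
    with False show ?thesis
      by (intro exI[of _ c]) (auto simp: not_less)
  qed
  then obtain c where c: "\<And>x. 0 \<le> (f x - c) * (g x - m)" by blast
  have "0 \<le> expectation (\<lambda>x. (f x - c) * (g x - m))"
    by (intro integral_nonneg_AE AE_I2 c)
  also have "(\<lambda>x. (f x - c) * (g x - m)) = (\<lambda>x. f x * g x - m * f x - c * g x + c * m)"
    by (auto simp: algebra_simps)
  also have "expectation \<dots> = expectation (\<lambda>x. f x * g x) - m * expectation f - c * m + c * m"
    using f g fg by (simp add: m_def prob_space)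
  finally show ?thesis
    by (simp add: m_def mult.commute)
qed

text \<open>By independence the joint law is a product measure, so Fubini integrates the
  probabilities of the slices. This replaces conditioning on \<open>X\<close>; the second conclusion
  makes the slice probability a legitimate integrand.\<close>

lemma (in prob_space) prob_indep_var_slice:
  assumes ind: "indep_var N X K Y"
    and P: "Measurable.pred (N \<Otimes>\<^sub>M K) (\<lambda>(x, y). P x y)"
  shows "\<P>(\<omega> in M. P (X \<omega>) (Y \<omega>)) = (LINT x|distr M N X. \<P>(\<omega> in M. P x (Y \<omega>)))"
    and "(\<lambda>x. \<P>(\<omega> in M. P x (Y \<omega>))) \<in> borel_measurable N"
proof -
  have [measurable]: "X \<in> measurable M N" "Y \<in> measurable M K"
    using ind by (auto dest: indep_var_rv1 indep_var_rv2)
  have X: "X \<omega> \<in> space N" and Y: "Y \<omega> \<in> space K" if "\<omega> \<in> space M" for \<omega>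
    using that by (auto intro: measurable_space)
  let ?\<mu> = "distr M N X" and ?\<nu> = "distr M K Y"
  interpret \<nu>: prob_space ?\<nu> by (rule prob_space_distr) simp
  define A where "A = {p \<in> space (N \<Otimes>\<^sub>M K). P (fst p) (snd p)}"
  have A[measurable]: "A \<in> sets (N \<Otimes>\<^sub>M K)"
    using P by (simp add: A_def pred_def case_prod_beta')
  have slice: "emeasure ?\<nu> (Pair x -` A) = ennreal \<P>(\<omega> in M. P x (Y \<omega>))" if "x \<in> space N" for x
  proof -
    have "emeasure ?\<nu> (Pair x -` A) = emeasure M (Y -` (Pair x -` A) \<inter> space M)"
      by (rule emeasure_distr) (auto intro: sets_Pair1)
    also have "Y -` (Pair x -` A) \<inter> space M = {\<omega> \<in> space M. P x (Y \<omega>)}"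
      using that Y by (auto simp: A_def space_pair_measure)
    finally show ?thesis by (simp add: emeasure_eq_measure)
  qed
  have m: "(\<lambda>x. measure ?\<nu> (Pair x -` A)) \<in> borel_measurable N"
    unfolding measure_def
    by (intro borel_measurable_enn2real \<nu>.measurable_emeasure_Pair) simp
  have "(\<lambda>x. \<P>(\<omega> in M. P x (Y \<omega>))) \<in> borel_measurable N \<longleftrightarrow>
      (\<lambda>x. measure ?\<nu> (Pair x -` A)) \<in> borel_measurable N"
    by (rule measurable_cong) (simp add: measure_def[of ?\<nu>] slice)
  with m show *: "(\<lambda>x. \<P>(\<omega> in M. P x (Y \<omega>))) \<in> borel_measurable N"
    by blast
  have "emeasure M {\<omega> \<in> space M. P (X \<omega>) (Y \<omega>)}
      = emeasure (distr M (N \<Otimes>\<^sub>M K) (\<lambda>\<omega>. (X \<omega>, Y \<omega>))) A"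
    by (subst emeasure_distr[OF _ A])
       (auto intro!: arg_cong[where f="emeasure M"] simp: A_def space_pair_measure X Y)
  also have "distr M (N \<Otimes>\<^sub>M K) (\<lambda>\<omega>. (X \<omega>, Y \<omega>)) = ?\<mu> \<Otimes>\<^sub>M ?\<nu>"
    using ind by (simp add: indep_var_distribution_eq)
  also have "emeasure (?\<mu> \<Otimes>\<^sub>M ?\<nu>) A = (\<integral>\<^sup>+x. emeasure ?\<nu> (Pair x -` A) \<partial>?\<mu>)"
    by (rule \<nu>.emeasure_pair_measure_alt) simp
  also have "\<dots> = (\<integral>\<^sup>+x. ennreal \<P>(\<omega> in M. P x (Y \<omega>)) \<partial>?\<mu>)"
    by (rule nn_integral_cong) (simp add: slice)
  finally show "\<P>(\<omega> in M. P (X \<omega>) (Y \<omega>)) = (LINT x|?\<mu>. \<P>(\<omega> in M. P x (Y \<omega>)))"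
    using * by (subst integral_eq_nn_integral) (simp_all add: measure_def[of M])
qed

text \<open>Independence of events that depend on disjoint blocks of coordinates. \<open>P\<close>
  and \<open>Q\<close> witness this dependence, while \<open>P'\<close> and \<open>Q'\<close> let
  the events be written directly on the sample space.\<close>

lemma (in prob_space) prob_indep_restrict:
  assumes ind: "indep_vars (\<lambda>_. N) X I" and JK: "J \<inter> K = {}" "J \<subseteq> I" "K \<subseteq> I"
    and [measurable]: "Measurable.pred (PiM J (\<lambda>_. N)) P" "Measurable.pred (PiM K (\<lambda>_. N)) Q"
    and P: "\<And>\<omega>. \<omega> \<in> space M \<Longrightarrow> P (restrict (\<lambda>i. X i \<omega>) J) = P' \<omega>"
    and Q: "\<And>\<omega>. \<omega> \<in> space M \<Longrightarrow> Q (restrict (\<lambda>i. X i \<omega>) K) = Q' \<omega>"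
  shows "\<P>(\<omega> in M. P' \<omega> \<and> Q' \<omega>) = \<P>(\<omega> in M. P' \<omega>) * \<P>(\<omega> in M. Q' \<omega>)"
proof -
  let ?X = "\<lambda>J \<omega>. restrict (\<lambda>i. X i \<omega>) J"
  have i: "indep_var (PiM J (\<lambda>_. N)) (?X J) (PiM K (\<lambda>_. N)) (?X K)"
    by (rule indep_var_restrict[OF ind JK])
  have sp: "?X J \<omega> \<in> space (PiM J (\<lambda>_. N))" "?X K \<omega> \<in> space (PiM K (\<lambda>_. N))"
    if "\<omega> \<in> space M" for \<omega>
    using measurable_space[OF indep_var_rv1[OF i] that] measurable_space[OF indep_var_rv2[OF i] that]
    by auto
  have "prob ((\<lambda>\<omega>. (?X J \<omega>, ?X K \<omega>)) -` ({f \<in> space (PiM J (\<lambda>_. N)). P f} \<times> {f \<in> space (PiM K (\<lambda>_. N)). Q f}) \<inter> space M)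
     = prob (?X J -` {f \<in> space (PiM J (\<lambda>_. N)). P f} \<inter> space M) * prob (?X K -` {f \<in> space (PiM K (\<lambda>_. N)). Q f} \<inter> space M)"
    by (rule indep_varD[OF i]) measurable
  also have "(\<lambda>\<omega>. (?X J \<omega>, ?X K \<omega>)) -` ({f \<in> space (PiM J (\<lambda>_. N)). P f} \<times> {f \<in> space (PiM K (\<lambda>_. N)). Q f}) \<inter> space M
     = {\<omega> \<in> space M. P' \<omega> \<and> Q' \<omega>}"
    using sp P Q by auto
  also have "?X J -` {f \<in> space (PiM J (\<lambda>_. N)). P f} \<inter> space M = {\<omega> \<in> space M. P' \<omega>}"
    using sp P by auto
  also have "?X K -` {f \<in> space (PiM K (\<lambda>_. N)). Q f} \<inter> space M = {\<omega> \<in> space M. Q' \<omega>}"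
    using sp Q by auto
  finally show ?thesis .
qed

text \<open>Once the coordinates in \<open>S \<inter> T\<close> are fixed to \<open>x\<close>, the
  two events are independent with probabilities \<open>f x\<close> and \<open>g x\<close>. Both
  decrease as the shared sum \<open>u x\<close> grows, so Chebyshev's inequality applies to them
  under the law of the shared coordinates.\<close>

lemma (in prob_space) prob_indep_sums_less_ge:
  fixes X :: "'i \<Rightarrow> 'a \<Rightarrow> real"
  assumes ind: "indep_vars (\<lambda>_. borel) X I" and ST: "S \<subseteq> I" "T \<subseteq> I" and [simp]: "finite S" "finite T"
  shows "\<P>(\<omega> in M. (\<Sum>i\<in>S. X i \<omega>) < a) * \<P>(\<omega> in M. (\<Sum>i\<in>T. X i \<omega>) < b)
    \<le> \<P>(\<omega> in M. (\<Sum>i\<in>S. X i \<omega>) < a \<and> (\<Sum>i\<in>T. X i \<omega>) < b)"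
proof -
  define U V W where "U \<omega> = (\<Sum>i\<in>S \<inter> T. X i \<omega>)" and "V \<omega> = (\<Sum>i\<in>S - T. X i \<omega>)"
    and "W \<omega> = (\<Sum>i\<in>T - S. X i \<omega>)" for \<omega>
  let ?X = "\<lambda>J \<omega>. restrict (\<lambda>i. X i \<omega>) J"
  have S: "(\<Sum>i\<in>S. X i \<omega>) = U \<omega> + V \<omega>" for \<omega>
    unfolding U_def V_def by (rule sum.Int_Diff) simp
  have T: "(\<Sum>i\<in>T. X i \<omega>) = U \<omega> + W \<omega>" for \<omega>
    unfolding U_def W_def Int_commute[of S T] by (rule sum.Int_Diff) simp
  let ?R = "S - T \<union> (T - S)"
  let ?N = "\<lambda>J. PiM J (\<lambda>_. borel) :: ('i \<Rightarrow> real) measure"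
  have "indep_var borel ((\<lambda>f. \<Sum>i\<in>S - T. f i) \<circ> ?X (S - T)) borel ((\<lambda>f. \<Sum>i\<in>T - S. f i) \<circ> ?X (T - S))"
    using ST by (intro indep_var_compose[OF indep_var_restrict[OF ind]]) auto
  then have VW: "indep_var borel V borel W"
    by (simp add: V_def[abs_def] W_def[abs_def] comp_def)
  have UR: "indep_var (?N (S \<inter> T)) (?X (S \<inter> T)) (?N ?R) (?X ?R)"
    using ST by (intro indep_var_restrict[OF ind]) auto
  define u :: "('i \<Rightarrow> real) \<Rightarrow> real" where "u x = (\<Sum>i\<in>S \<inter> T. x i)" for x
  \<comment> \<open>The sums are rewritten as functions of the two restricted families, the form to
    which \<open>slice\<close> applies.\<close>
  have U_eq: "U \<omega> = u (?X (S \<inter> T) \<omega>)" for \<omega>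
    by (simp add: U_def u_def)
  have V_eq: "V \<omega> = (\<Sum>i\<in>S - T. ?X ?R \<omega> i)" and W_eq: "W \<omega> = (\<Sum>i\<in>T - S. ?X ?R \<omega> i)" for \<omega>
    by (auto simp: V_def W_def intro!: sum.cong)
  have u[measurable]: "u \<in> borel_measurable (?N (S \<inter> T))"
    unfolding u_def by measurable
  have m[measurable]: "(\<lambda>y. \<Sum>i\<in>S - T. y i) \<in> borel_measurable (?N ?R)"
    "(\<lambda>y. \<Sum>i\<in>T - S. y i) \<in> borel_measurable (?N ?R)"
    by (auto intro!: borel_measurable_sum)
  have [measurable]: "V \<in> borel_measurable M" "W \<in> borel_measurable M"
    using VW by (auto dest: indep_var_rv1 indep_var_rv2)
  define f g where "f x = \<P>(\<omega> in M. u x + V \<omega> < a)" and "g x = \<P>(\<omega> in M. u x + W \<omega> < b)" for x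
  note slice = prob_indep_var_slice[OF UR]
  have f: "\<P>(\<omega> in M. U \<omega> + V \<omega> < a) = (LINT x|distr M (?N (S \<inter> T)) (?X (S \<inter> T)). f x)"
      "f \<in> borel_measurable (?N (S \<inter> T))"
    using slice[of "\<lambda>x y. u x + (\<Sum>i\<in>S - T. y i) < a"]
    unfolding f_def[abs_def] U_eq V_eq by simp_all
  have g: "\<P>(\<omega> in M. U \<omega> + W \<omega> < b) = (LINT x|distr M (?N (S \<inter> T)) (?X (S \<inter> T)). g x)"
      "g \<in> borel_measurable (?N (S \<inter> T))"
    using slice[of "\<lambda>x y. u x + (\<Sum>i\<in>T - S. y i) < b"]
    unfolding g_def[abs_def] U_eq W_eq by simp_all
  \<comment> \<open>For fixed \<open>x\<close> only \<open>V\<close> and \<open>W\<close> are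
    random, and they use disjoint sets of coordinates.\<close>
  have fg_eq: "\<P>(\<omega> in M. u x + V \<omega> < a \<and> u x + W \<omega> < b) = f x * g x" for x
  proof -
    have "prob ((\<lambda>\<omega>. (V \<omega>, W \<omega>)) -` ({v. u x + v < a} \<times> {w. u x + w < b}) \<inter> space M)
      = prob (V -` {v. u x + v < a} \<inter> space M) * prob (W -` {w. u x + w < b} \<inter> space M)"
      by (rule indep_varD[OF VW]) auto
    then show ?thesis
      by (simp add: f_def g_def vimage_def Int_def conj_commute)
  qed
  have fg: "\<P>(\<omega> in M. U \<omega> + V \<omega> < a \<and> U \<omega> + W \<omega> < b)
      = (LINT x|distr M (?N (S \<inter> T)) (?X (S \<inter> T)). f x * g x)"
    using slice(1)[of "\<lambda>x y. u x + (\<Sum>i\<in>S - T. y i) < a \<and> u x + (\<Sum>i\<in>T - S. y i) < b"]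
    unfolding fg_eq[symmetric] U_eq V_eq W_eq by simp
  interpret \<mu>: prob_space "distr M (?N (S \<inter> T)) (?X (S \<inter> T))"
    by (rule prob_space_distr) (rule indep_var_rv1[OF UR])
  have f01: "0 \<le> f x" "f x \<le> 1" and g01: "0 \<le> g x" "g x \<le> 1" for x
    by (auto simp: f_def g_def)
  show ?thesis
    unfolding S T f g fg
  proof (rule \<mu>.chebyshev_integral_inequality)
    show "integrable (distr M (?N (S \<inter> T)) (?X (S \<inter> T))) f"
      using f01 f by (auto intro!: \<mu>.integrable_const_bound[of _ 1])
    show "integrable (distr M (?N (S \<inter> T)) (?X (S \<inter> T))) g"
      using g01 g by (auto intro!: \<mu>.integrable_const_bound[of _ 1])
    show "integrable (distr M (?N (S \<inter> T)) (?X (S \<inter> T))) (\<lambda>x. f x * g x)"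
      using f01 g01 f g
      by (auto intro!: \<mu>.integrable_const_bound[of _ 1] AE_I2 simp: mult_le_one)
    show "bdd_above (range f)" "bdd_below (range f)"
      using f01 by (auto intro!: bdd_aboveI[of _ 1] bdd_belowI[of _ 0])
    \<comment> \<open>\<open>f\<close> and \<open>g\<close> are antitone in \<open>u\<close>: a
      strict increase of \<open>g\<close> from \<open>x\<close> to \<open>y\<close> forces
      \<open>u y \<le> u x\<close>, and then \<open>f\<close> cannot decrease.\<close>
    show "f x \<le> f y" if "g x < g y" for x y
    proof -
      have "u y \<le> u x"
      proof (rule ccontr)
        assume "\<not> u y \<le> u x"
        then have "g y \<le> g x"
          unfolding g_def by (intro finite_measure_mono) auto
        with that show False by simp
      qed
      then show ?thesis
        unfolding f_def by (intro finite_measure_mono) auto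
    qed
  qed
qed

section \<open>The binomial law of error counts\<close>

text \<open>The event is the disjoint union of the events \<open>E K\<close> that the hits are
  exactly \<open>K\<close>. Independence gives each a probability depending on \<open>card K\<close>
  only, and grouping by cardinality produces the binomial coefficients.\<close>

lemma (in prob_space) prob_card_less:
  fixes X :: "'i \<Rightarrow> 'a \<Rightarrow> 'b"
  assumes ind: "indep_vars (\<lambda>_. N) X I" and J: "finite J" "J \<subseteq> I" and B: "B \<in> sets N"
    and p: "\<And>i. i \<in> J \<Longrightarrow> \<P>(\<omega> in M. X i \<omega> \<in> B) = p"
  shows "\<P>(\<omega> in M. card {i \<in> J. X i \<omega> \<in> B} < k)
    = (\<Sum>m<k. real (card J choose m) * p ^ m * (1 - p) ^ (card J - m))"
proof -
  have X[measurable]: "X i \<in> measurable M N" if "i \<in> J" for i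
    using ind J that by (auto simp: indep_vars_def)
  define E where "E K = {\<omega> \<in> space M. {i \<in> J. X i \<omega> \<in> B} = K}" for K
  have E_eq: "E K = {\<omega> \<in> space M. \<forall>i\<in>J. X i \<omega> \<in> (if i \<in> K then B else space N - B)}" if "K \<subseteq> J" for K
    using that measurable_space[OF X] by (auto simp: E_def)
  have E_sets: "E K \<in> events" if "K \<subseteq> J" for K
    unfolding E_eq[OF that] using J(1) B
    by (intro sets.sets_Collect_finite_All measurable_sets_Collect[OF X]) auto
  have prob_E: "prob (E K) = p ^ card K * (1 - p) ^ (card J - card K)" if "K \<subseteq> J" for K
  proof (cases "J = {}")
    \<comment> \<open>The empty case is separate because an intersection over no indices is
      \<open>UNIV\<close> and not \<open>space M\<close>.\<close>
    case True
    then show ?thesis using that by (simp add: E_def prob_space)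
  next
    case False
    have q: "\<P>(\<omega> in M. X i \<omega> \<in> space N - B) = 1 - p" if "i \<in> J" for i
    proof -
      have "{\<omega> \<in> space M. X i \<omega> \<in> B} \<in> events"
        using measurable_sets_Collect[OF X[OF that], of "\<lambda>x. x \<in> B"] B by simp
      from prob_compl[OF this] show ?thesis
        using p[OF that] measurable_space[OF X[OF that]]
        by (auto intro!: arg_cong[where f=prob] elim!: back_subst[where P="\<lambda>x. x = _"])
    qed
    have "E K = (\<Inter>i\<in>J. X i -` (if i \<in> K then B else space N - B) \<inter> space M)"
      unfolding E_eq[OF that] using False by auto
    also have "prob \<dots> = (\<Prod>i\<in>J. prob (X i -` (if i \<in> K then B else space N - B) \<inter> space M))"
      using False J B by (intro indep_varsD[OF ind]) auto
    also have "\<dots> = (\<Prod>i\<in>J. if i \<in> K then p else 1 - p)"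
      using p q by (intro prod.cong) (auto simp: vimage_def Int_def conj_commute)
    also have "\<dots> = p ^ card K * (1 - p) ^ (card J - card K)"
      using J(1) that by (simp add: prod.If_cases Int_absorb1 card_Diff_subset finite_subset
          Diff_eq[symmetric])
    finally show ?thesis .
  qed
  let ?F = "{K. K \<subseteq> J \<and> card K < k}"
  have fin: "finite ?F" using J(1) by simp
  have "{\<omega> \<in> space M. card {i \<in> J. X i \<omega> \<in> B} < k} = (\<Union>K\<in>?F. E K)"
    by (auto simp: E_def)
  also have "prob \<dots> = (\<Sum>K\<in>?F. prob (E K))"
  proof (rule finite_measure_finite_Union[OF fin])
    show "E ` ?F \<subseteq> events" using E_sets by blast
    show "disjoint_family_on E ?F" by (auto simp: disjoint_family_on_def E_def)
  qed
  also have "\<dots> = (\<Sum>K\<in>?F. p ^ card K * (1 - p) ^ (card J - card K))"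
    by (intro sum.cong) (auto simp: prob_E)
  also have "\<dots> = (\<Sum>m<k. \<Sum>K\<in>{K \<in> ?F. card K = m}. p ^ card K * (1 - p) ^ (card J - card K))"
    using fin by (intro sum.group[symmetric]) auto
  also have "\<dots> = (\<Sum>m<k. \<Sum>K\<in>{K. K \<subseteq> J \<and> card K = m}. p ^ m * (1 - p) ^ (card J - m))"
    by (intro sum.cong refl) auto
  also have "\<dots> = (\<Sum>m<k. real (card J choose m) * p ^ m * (1 - p) ^ (card J - m))"
    using n_subsets[OF J(1)] by (simp add: mult.assoc)
  finally show ?thesis .
qed

text \<open>The strict bound \<open>m < k\<close> corresponds to the integer limit
  \<open>k - 1\<close>; for \<open>k = 0\<close> this limit is -1 and both sums are empty.\<close>

lemma bsc_range_prob_from_zero: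
  "bsc_range_prob p (int N) 0 (int k - 1) = (\<Sum>m<k. real (N choose m) * p ^ m * (1 - p) ^ (N - m))"
  unfolding bsc_range_prob_def by (intro sum.cong) auto

section \<open>Gaussian tails\<close>

text \<open>Reflecting and scaling turns \<open>X\<close> into a standard normal variable. The
  strict form serves the comparison of codewords, the other one the hard decision, which counts 0 as
  an error.\<close>

lemma (in prob_space) normal_lower_tail:
  assumes X: "distributed M lborel X (normal_density 0 s)" and s: "s > 0"
  shows "\<P>(\<omega> in M. X \<omega> < - a) = gaussian_Q (a / s)" "\<P>(\<omega> in M. X \<omega> \<le> - a) = gaussian_Q (a / s)"
proof -
  define Y where "Y \<omega> = - (X \<omega> / s)" for \<omega>
  have Y: "distributed M lborel Y std_normal_density"
    using normal_density_affine[OF X s, of "- 1 / s" 0] s by (simp add: Y_def[abs_def])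
  have eq: "X \<omega> < - a \<longleftrightarrow> a / s < Y \<omega>" "X \<omega> \<le> - a \<longleftrightarrow> a / s \<le> Y \<omega>" for \<omega>
    using s by (auto simp: Y_def field_simps)
  \<comment> \<open>Allowing any \<open>A\<close> that equals the closed half-line up to a null set
    covers the strict and the non-strict inequality at once.\<close>
  have tail: "prob (Y -` A \<inter> space M) = gaussian_Q (a / s)"
    if "A \<in> sets lborel" "AE x in lborel. x \<in> A \<longleftrightarrow> a / s \<le> x" for A
  proof -
    have "emeasure M (Y -` A \<inter> space M) = (\<integral>\<^sup>+x. ennreal (std_normal_density x) * indicator A x \<partial>lborel)"
      using distributed_emeasure[OF Y that(1)] .
    also have "\<dots> = (\<integral>\<^sup>+x. ennreal (indicator {a / s..} x * std_normal_density x) \<partial>lborel)"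
      by (rule nn_integral_cong_AE, use that(2) in \<open>rule eventually_mono\<close>) (simp split: split_indicator)
    finally have "prob (Y -` A \<inter> space M)
        = enn2real (\<integral>\<^sup>+x. ennreal (indicator {a / s..} x * std_normal_density x) \<partial>lborel)"
      by (simp add: measure_def)
    then show ?thesis
      unfolding gaussian_Q_def set_lebesgue_integral_def real_scaleR_def
      by (subst integral_eq_nn_integral) auto
  qed
  have "AE x in lborel. x \<in> {a / s<..} \<longleftrightarrow> a / s \<le> x"
    using AE_lborel_singleton[of "a / s"] by (rule eventually_mono) auto
  from tail[OF _ this] show "\<P>(\<omega> in M. X \<omega> < - a) = gaussian_Q (a / s)"
    by (simp add: eq vimage_def Int_def conj_commute)
  show "\<P>(\<omega> in M. X \<omega> \<le> - a) = gaussian_Q (a / s)"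
    using tail[of "{a / s..}"] by (simp add: eq vimage_def Int_def conj_commute)
qed

section \<open>Geometry of BPSK and hard decisions\<close>

lemma bpsk_zero: "bpsk 0 $ t = 1"
  by (simp add: bpsk_def)

text \<open>The squared distances differ only on the support of \<open>c\<close>, where each
  coordinate contributes \<open>(y + 1)^2 - (y - 1)^2 = 4 * y\<close>.\<close>

lemma dist_bpsk_less_iff:
  fixes y :: "real ^ 'n"
  shows "dist y (bpsk c) < dist y (bpsk 0) \<longleftrightarrow> (\<Sum>t | c $ t \<noteq> 0. y $ t) < 0"
proof -
  have "dist y (bpsk c) < dist y (bpsk 0)
    \<longleftrightarrow> (\<Sum>t\<in>UNIV. (y $ t - bpsk c $ t)\<^sup>2) < (\<Sum>t\<in>UNIV. (y $ t - bpsk 0 $ t)\<^sup>2)"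
    by (simp add: dist_vec_def L2_set_def dist_real_def)
  also have "(\<Sum>t\<in>UNIV. (y $ t - bpsk c $ t)\<^sup>2)
    = (\<Sum>t\<in>UNIV. (y $ t - bpsk 0 $ t)\<^sup>2 + (if c $ t \<noteq> 0 then 4 * y $ t else 0))"
    by (intro sum.cong) (auto simp: bpsk_def power2_eq_square algebra_simps)
  also have "\<dots> = (\<Sum>t\<in>UNIV. (y $ t - bpsk 0 $ t)\<^sup>2) + 4 * (\<Sum>t | c $ t \<noteq> 0. y $ t)"
    by (simp add: sum.distrib sum.If_cases sum_distrib_left)
  finally show ?thesis by simp
qed

lemma hamming_weight_hard_decision:
  "hamming_weight (hard_decision y) = card {t. y $ t \<le> 0}"
  by (simp add: hamming_weight_def hard_decision_def not_less)

text \<open>A negative sum has a nonpositive summand, so at least one error lies in \<open>S\<close>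
  and hence in \<open>T\<close>. This is the source of the limit \<open>d\<^sub>s - 1\<close> in the
  bounds.\<close>

lemma card_less_of_sum_neg:
  fixes y :: "'i::finite \<Rightarrow> real"
  assumes "(\<Sum>t\<in>S. y t) < 0" "S \<subseteq> T" "card {t. y t \<le> 0} \<le> k"
  shows "card {t \<in> - T. y t \<le> 0} < k"
proof -
  have "\<exists>s\<in>S. y s \<le> 0"
  proof (rule ccontr)
    assume "\<not> ?thesis"
    then have "0 \<le> (\<Sum>t\<in>S. y t)"
      by (intro sum_nonneg) (auto simp: not_le less_imp_le)
    with assms(1) show False by simp
  qed
  then obtain s where s: "s \<in> S" "y s \<le> 0" by blast
  have "{t \<in> - T. y t \<le> 0} \<subset> {t. y t \<le> 0}"
    using s assms(2) by auto
  then have "card {t \<in> - T. y t \<le> 0} < card {t. y t \<le> 0}"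
    by (intro psubset_card_mono) simp_all
  with assms(3) show ?thesis by linarith
qed

section \<open>Union bound over pairs, and measurability of counts\<close>

text \<open>Any two distinct elements may be paired, so the induction removes two at a time. Parity
  is preserved, and an odd cardinality leaves one element, which costs
  \<open>\<gamma>\<close>.\<close>

lemma (in finite_measure) measure_Union_le_pairs:
  assumes "finite W" and F: "\<And>c. c \<in> W \<Longrightarrow> F c \<in> sets M"
    and pair: "\<And>b c. b \<in> W \<Longrightarrow> c \<in> W \<Longrightarrow> b \<noteq> c \<Longrightarrow> measure M (F b \<union> F c) \<le> \<beta>"
    and single: "\<And>c. c \<in> W \<Longrightarrow> measure M (F c) \<le> \<gamma>"
  shows "measure M (\<Union>c\<in>W. F c) \<le> real (card W div 2) * \<beta> + (if odd (card W) then \<gamma> else 0)"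
  using assms
proof (induction "card W" arbitrary: W rule: less_induct)
  case less
  consider "card W = 0" | "card W = 1" | "card W \<ge> 2" by linarith
  then show ?case
  proof cases
    case 1
    with less.prems show ?thesis by simp
  next
    case 2
    then obtain c where "W = {c}" by (auto simp: card_1_singleton_iff)
    with less.prems show ?thesis by simp
  next
    case 3
    then obtain T where "T \<subseteq> W" "card T = 2"
      by (meson obtain_subset_with_card_n)
    then obtain b c where bc: "b \<in> W" "c \<in> W" "b \<noteq> c"
      by (auto simp: card_2_iff)
    let ?W = "W - {b, c}"
    have card: "card W = Suc (Suc (card ?W))"
      using bc 3 by (simp add: card_Diff_subset)
    have "measure M (\<Union>c\<in>?W. F c) \<le> real (card ?W div 2) * \<beta> + (if odd (card ?W) then \<gamma> else 0)"
      using less.prems card by (intro less.hyps) auto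
    moreover have "measure M (F b \<union> F c) \<le> \<beta>"
      using bc by (rule less.prems)
    moreover have "(\<Union>c\<in>W. F c) = (F b \<union> F c) \<union> (\<Union>c\<in>?W. F c)"
      using bc by auto
    moreover have "measure M ((F b \<union> F c) \<union> (\<Union>c\<in>?W. F c)) \<le> measure M (F b \<union> F c) + measure M (\<Union>c\<in>?W. F c)"
      using bc less.prems by (intro measure_Un_le) auto
    ultimately show ?thesis
      by (simp add: card algebra_simps)
  qed
qed

text \<open>The count is a finite sum of indicators, hence a measurable real function.\<close>

lemma pred_card_less:
  assumes J: "finite J" and P: "\<And>i. i \<in> J \<Longrightarrow> Measurable.pred M (P i)"
  shows "Measurable.pred M (\<lambda>x. card {i \<in> J. P i x} < k)"
proof -
  have "Measurable.pred M (\<lambda>x. (\<Sum>i\<in>J. indicator {x \<in> space M. P i x} x) < real k)"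
    using P by (intro borel_measurable_pred_less borel_measurable_sum borel_measurable_indicator
        borel_measurable_const) (simp add: pred_def)
  also have "?this \<longleftrightarrow> Measurable.pred M (\<lambda>x. card {i \<in> J. P i x} < k)"
  proof (rule measurable_cong)
    fix x assume "x \<in> space M"
    then have "(\<Sum>i\<in>J. indicator {x \<in> space M. P i x} x) = (\<Sum>i\<in>J. if P i x then 1 else 0 :: real)"
      by (intro sum.cong) auto
    also have "\<dots> = real (card {i \<in> J. P i x})"
      using J by (simp add: sum.If_cases Int_def)
    finally show "((\<Sum>i\<in>J. indicator {x \<in> space M. P i x} x) < real k) = (card {i \<in> J. P i x} < k)"
      by simp
  qed
  finally show ?thesis .
qed

lemma bsc_range_prob_cong_nat: "nat N = nat N' \<Longrightarrow> bsc_range_prob p N l u = bsc_range_prob p N' l u"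
  by (simp add: bsc_range_prob_def)

section \<open>The bound for codewords of one weight\<close>

theorem theorem3:
  fixes M :: "'a measure"
    and z :: "'a \<Rightarrow> real ^ 'n"
    and C :: "(bit ^ 'n) set"
    and \<sigma> p\<^sub>b q :: real
    and n d d\<^sub>s A :: nat
    and y :: "'a \<Rightarrow> real ^ 'n"
  assumes "prob_space M"
    and "\<sigma> > 0"
    and "awgn M \<sigma> z"
    and "\<And>\<omega>. y \<omega> = bpsk 0 + z \<omega>"
    and "vec.subspace C"
    and "n = CARD('n)"
    and "d \<ge> 1"
    and "d\<^sub>s \<le> n"
    and "A = card (weight_codewords C d)"
    and "A \<ge> 1"
    and "p\<^sub>b = gaussian_Q (1 / \<sigma>)"
    and "q = gaussian_Q (sqrt (real d) / \<sigma>)"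
  shows
    "(even A \<longrightarrow>
        measure M {\<omega> \<in> space M. weight_error C d (y \<omega>) \<and>
                                hamming_weight (hard_decision (y \<omega>)) \<le> d\<^sub>s}
        \<le> real A * (q - 1 / 2 * q\<^sup>2) * bsc_range_prob p\<^sub>b (int n - 2 * int d) 0 (int d\<^sub>s - 1)) \<and>
     (odd A \<longrightarrow>
        measure M {\<omega> \<in> space M. weight_error C d (y \<omega>) \<and>
                                hamming_weight (hard_decision (y \<omega>)) \<le> d\<^sub>s}
        \<le> (real A - 1) * (q - 1 / 2 * q\<^sup>2) * bsc_range_prob p\<^sub>b (int n - 2 * int d) 0 (int d\<^sub>s - 1)
          + q * bsc_range_prob p\<^sub>b (int n - int d) 0 (int d\<^sub>s - 1))"
proof -
  interpret prob_space M by fact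
  let ?S = "\<lambda>c :: bit ^ 'n. {t. c $ t \<noteq> 0}"
  let ?W = "weight_codewords C d"
  have ind_z: "indep_vars (\<lambda>_. borel) (\<lambda>t \<omega>. z \<omega> $ t) UNIV"
    and normal: "\<And>t. distributed M lborel (\<lambda>\<omega>. z \<omega> $ t) (normal_density 0 \<sigma>)"
    using \<open>awgn M \<sigma> z\<close> by (auto simp: awgn_def)
  have y: "y \<omega> $ t = 1 + z \<omega> $ t" for \<omega> t
    by (simp add: assms(4) bpsk_zero)
  have ind: "indep_vars (\<lambda>_. borel) (\<lambda>t \<omega>. y \<omega> $ t) UNIV"
    unfolding y by (rule indep_vars_compose2[OF ind_z]) simp
  have ym[measurable]: "(\<lambda>\<omega>. y \<omega> $ t) \<in> borel_measurable M" for t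
    using ind by (simp add: indep_vars_def)
  have prob_bit: "\<P>(\<omega> in M. y \<omega> $ t \<in> {..0}) = p\<^sub>b" for t
    using normal_lower_tail(2)[OF normal \<open>\<sigma> > 0\<close>, of t 1]
    by (simp add: y assms(11) algebra_simps le_diff_eq[symmetric])
  \<comment> \<open>The noise sum over \<open>d\<close> coordinates has standard deviation
    \<open>sqrt d * \<sigma>\<close> and must fall below \<open>- d\<close>; the quotient of the two
    simplifies to \<open>sqrt d / \<sigma>\<close>.\<close>
  have prob_sum: "\<P>(\<omega> in M. (\<Sum>t\<in>S. y \<omega> $ t) < 0) = q" if "card S = d" for S
  proof -
    have "S \<noteq> {}" using that \<open>d \<ge> 1\<close> by auto
    then have "distributed M lborel (\<lambda>\<omega>. \<Sum>t\<in>S. z \<omega> $ t)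
        (normal_density (\<Sum>t\<in>S. 0) (sqrt (\<Sum>t\<in>S. \<sigma>\<^sup>2)))"
      using indep_vars_subset[OF ind_z, of S] normal \<open>\<sigma> > 0\<close>
      by (intro sum_indep_normal) auto
    then have "distributed M lborel (\<lambda>\<omega>. \<Sum>t\<in>S. z \<omega> $ t) (normal_density 0 (sqrt d * \<sigma>))"
      using that \<open>\<sigma> > 0\<close> by (simp add: real_sqrt_mult)
    moreover have "sqrt d * \<sigma> > 0" using \<open>d \<ge> 1\<close> \<open>\<sigma> > 0\<close> by simp
    ultimately have "\<P>(\<omega> in M. (\<Sum>t\<in>S. z \<omega> $ t) < - real d) = gaussian_Q (d / (sqrt d * \<sigma>))"
      by (rule normal_lower_tail(1))
    also have "d / (sqrt d * \<sigma>) = sqrt d / \<sigma>"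
      using \<open>d \<ge> 1\<close> \<open>\<sigma> > 0\<close> by (simp add: field_simps)
    moreover have "(\<Sum>t\<in>S. y \<omega> $ t) < 0 \<longleftrightarrow> (\<Sum>t\<in>S. z \<omega> $ t) < - real d" for \<omega>
      using that by (simp add: y sum.distrib) linarith
    ultimately show ?thesis
      by (simp add: assms(12))
  qed
  have prob_outside: "\<P>(\<omega> in M. card {t \<in> - T. y \<omega> $ t \<le> 0} < d\<^sub>s)
      = bsc_range_prob p\<^sub>b (int (n - card T)) 0 (int d\<^sub>s - 1)" for T
    using prob_card_less[OF ind, of "- T" "{..0}" p\<^sub>b d\<^sub>s] prob_bit
    by (simp add: bsc_range_prob_from_zero Compl_eq_Diff_UNIV card_Diff_subset \<open>n = CARD('n)\<close>)
  \<comment> \<open>The disjunction serves pairs of codewords; a single codeword is the case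
    \<open>S' = S\<close>.\<close>
  have prob_split: "\<P>(\<omega> in M. ((\<Sum>t\<in>S. y \<omega> $ t) < 0 \<or> (\<Sum>t\<in>S'. y \<omega> $ t) < 0) \<and>
        card {t \<in> - T. y \<omega> $ t \<le> 0} < d\<^sub>s)
      = \<P>(\<omega> in M. (\<Sum>t\<in>S. y \<omega> $ t) < 0 \<or> (\<Sum>t\<in>S'. y \<omega> $ t) < 0) *
        bsc_range_prob p\<^sub>b (int (n - card T)) 0 (int d\<^sub>s - 1)"
    if "S \<subseteq> T" "S' \<subseteq> T" for S S' T
    unfolding prob_outside[symmetric]
  proof (rule prob_indep_restrict[OF ind])
    show "Measurable.pred (PiM T (\<lambda>_. borel))
        (\<lambda>f :: 'n \<Rightarrow> real. (\<Sum>t\<in>S. f t) < 0 \<or> (\<Sum>t\<in>S'. f t) < 0)"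
      using that by (intro pred_intros_logic borel_measurable_pred_less borel_measurable_sum
          borel_measurable_const measurable_component_singleton) auto
    show "Measurable.pred (PiM (- T) (\<lambda>_. borel)) (\<lambda>f :: 'n \<Rightarrow> real. card {t \<in> - T. f t \<le> 0} < d\<^sub>s)"
      by (intro pred_card_less ) auto
    fix \<omega>
    have "(\<Sum>t\<in>R. restrict (\<lambda>t. y \<omega> $ t) T t) = (\<Sum>t\<in>R. y \<omega> $ t)" if "R \<subseteq> T" for R
      using that by (intro sum.cong) auto
    with that show "((\<Sum>t\<in>S. restrict (\<lambda>t. y \<omega> $ t) T t) < 0 \<or> (\<Sum>t\<in>S'. restrict (\<lambda>t. y \<omega> $ t) T t) < 0)
        = ((\<Sum>t\<in>S. y \<omega> $ t) < 0 \<or> (\<Sum>t\<in>S'. y \<omega> $ t) < 0)"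
      by simp
    show "(card {t \<in> - T. restrict (\<lambda>t. y \<omega> $ t) (- T) t \<le> 0} < d\<^sub>s) = (card {t \<in> - T. y \<omega> $ t \<le> 0} < d\<^sub>s)"
      by (simp cong: conj_cong)
  qed auto
  \<comment> \<open>\<open>< Suc d\<^sub>s\<close> expresses \<open>\<le> d\<^sub>s\<close> in the
    strict form for which measurability of counts is available.\<close>
  define F where "F c = {\<omega> \<in> space M. (\<Sum>t\<in>?S c. y \<omega> $ t) < 0 \<and> card {t. y \<omega> $ t \<le> 0} < Suc d\<^sub>s}" for c
  define B1 B2 where "B1 = bsc_range_prob p\<^sub>b (int (n - d)) 0 (int d\<^sub>s - 1)"
    and "B2 = bsc_range_prob p\<^sub>b (int (n - 2 * d)) 0 (int d\<^sub>s - 1)"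
  \<comment> \<open>Lengths enter through \<open>nat\<close>, so the integer differences may become
    truncated ones, also when \<open>2 * d > n\<close>.\<close>
  have B: "bsc_range_prob p\<^sub>b (int n - int d) 0 (int d\<^sub>s - 1) = B1"
    "bsc_range_prob p\<^sub>b (int n - 2 * int d) 0 (int d\<^sub>s - 1) = B2"
    unfolding B1_def B2_def by (intro bsc_range_prob_cong_nat; linarith)+
  have card_S: "card (?S c) = d" if "c \<in> ?W" for c
    using that by (simp add: weight_codewords_def hamming_weight_def)
  have count_m[measurable]: "Measurable.pred M (\<lambda>\<omega>. card {t \<in> J. y \<omega> $ t \<le> 0} < k)" for J k
    by (rule pred_card_less) auto
  have F_sets: "F c \<in> events" for c
    using count_m[of UNIV "Suc d\<^sub>s"] by (simp add: F_def)
  \<comment> \<open>The total error count depends on all coordinates. Passing to the count outside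
    \<open>T\<close> gives a larger event whose two conditions are independent.\<close>
  have F_subset: "F c \<subseteq> {\<omega> \<in> space M. (\<Sum>t\<in>?S c. y \<omega> $ t) < 0 \<and> card {t \<in> - T. y \<omega> $ t \<le> 0} < d\<^sub>s}"
    if "?S c \<subseteq> T" for c T
    unfolding F_def less_Suc_eq_le using card_less_of_sum_neg[OF _ that] by blast
  have single: "prob (F c) \<le> q * B1" if "c \<in> ?W" for c
  proof -
    have "prob (F c) \<le> \<P>(\<omega> in M. ((\<Sum>t\<in>?S c. y \<omega> $ t) < 0 \<or> (\<Sum>t\<in>?S c. y \<omega> $ t) < 0) \<and>
        card {t \<in> - ?S c. y \<omega> $ t \<le> 0} < d\<^sub>s)"
    proof (rule finite_measure_mono)
      show "{\<omega> \<in> space M. ((\<Sum>t\<in>?S c. y \<omega> $ t) < 0 \<or> (\<Sum>t\<in>?S c. y \<omega> $ t) < 0) \<and>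
        card {t \<in> - ?S c. y \<omega> $ t \<le> 0} < d\<^sub>s} \<in> events"
        by measurable
    qed (use F_subset[of c "?S c"] in blast)
    also have "\<dots> = q * B1"
      using prob_split[of "?S c" "?S c" "?S c"] prob_sum card_S[OF that] by (simp add: B1_def)
    finally show ?thesis .
  qed
  have pair: "prob (F b \<union> F c) \<le> (2 * q - q\<^sup>2) * B2" if "b \<in> ?W" "c \<in> ?W" for b c
  proof -
    \<comment> \<open>Fixing the size of \<open>T\<close> makes the outside factor equal to
      \<open>B2\<close> for every pair, whatever the overlap of the supports.\<close>
    have "card (?S b \<union> ?S c) \<le> min n (2 * d)"
      using card_Un_le[of "?S b" "?S c"] card_S that card_mono[of UNIV "?S b \<union> ?S c"]
      by (simp add: \<open>n = CARD('n)\<close>)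
    then obtain T where T: "?S b \<union> ?S c \<subseteq> T" "card T = min n (2 * d)"
      using exists_subset_between[of "?S b \<union> ?S c" "min n (2 * d)" UNIV] \<open>n = CARD('n)\<close> by auto
    let ?b = "\<lambda>\<omega>. (\<Sum>t\<in>?S b. y \<omega> $ t) < 0" and ?c = "\<lambda>\<omega>. (\<Sum>t\<in>?S c. y \<omega> $ t) < 0"
    have "prob (F b \<union> F c) \<le> \<P>(\<omega> in M. (?b \<omega> \<or> ?c \<omega>) \<and> card {t \<in> - T. y \<omega> $ t \<le> 0} < d\<^sub>s)"
    proof (rule finite_measure_mono)
      show "{\<omega> \<in> space M. (?b \<omega> \<or> ?c \<omega>) \<and> card {t \<in> - T. y \<omega> $ t \<le> 0} < d\<^sub>s} \<in> events"
        by measurable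
    qed (use F_subset[of b T] F_subset[of c T] T(1) in blast)
    also have "\<dots> = \<P>(\<omega> in M. ?b \<omega> \<or> ?c \<omega>) * B2"
      using prob_split[of "?S b" T "?S c"] T by (simp add: B2_def min_def)
    also have "\<dots> \<le> (2 * q - q\<^sup>2) * B2"
    proof (rule mult_right_mono)
      \<comment> \<open>Inclusion-exclusion gives \<open>2 * q\<close> minus the joint probability,
        which positive correlation bounds below by \<open>q\<close> squared.\<close>
      have "\<P>(\<omega> in M. ?b \<omega> \<or> ?c \<omega>) = \<P>(\<omega> in M. ?b \<omega>) + \<P>(\<omega> in M. ?c \<omega>) - \<P>(\<omega> in M. ?b \<omega> \<and> ?c \<omega>)"
        using measure_Un3[of "{\<omega> \<in> space M. ?b \<omega>}" M "{\<omega> \<in> space M. ?c \<omega>}"]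
        by (simp add: Collect_disj_eq[symmetric] conj_disj_distribL[symmetric] fmeasurable_eq_sets Int_def conj_ac)
      moreover have "\<P>(\<omega> in M. ?b \<omega>) * \<P>(\<omega> in M. ?c \<omega>) \<le> \<P>(\<omega> in M. ?b \<omega> \<and> ?c \<omega>)"
        by (rule prob_indep_sums_less_ge[OF ind]) auto
      ultimately show "\<P>(\<omega> in M. ?b \<omega> \<or> ?c \<omega>) \<le> 2 * q - q\<^sup>2"
        using that card_S by (simp add: prob_sum power2_eq_square)
      \<comment> \<open>Nonnegativity of \<open>B2\<close> is read off from its meaning as a
        probability.\<close>
      have "B2 = \<P>(\<omega> in M. card {t \<in> - T. y \<omega> $ t \<le> 0} < d\<^sub>s)"
        unfolding prob_outside B2_def T(2) by (simp add: min_def)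
      then show "0 \<le> B2" by simp
    qed
    finally show ?thesis .
  qed
  have "measure M {\<omega> \<in> space M. weight_error C d (y \<omega>) \<and> hamming_weight (hard_decision (y \<omega>)) \<le> d\<^sub>s}
      = prob (\<Union>c\<in>?W. F c)"
    by (rule arg_cong[where f=prob])
       (auto simp: F_def weight_error_def dist_bpsk_less_iff hamming_weight_hard_decision less_Suc_eq_le)
  \<comment> \<open>Finiteness of the set of codewords follows from its positive cardinality
    \<open>A\<close>.\<close>
  also have "\<dots> \<le> real (card ?W div 2) * ((2 * q - q\<^sup>2) * B2) + (if odd (card ?W) then q * B1 else 0)"
    using \<open>A \<ge> 1\<close> \<open>A = card ?W\<close> pair single F_sets
    by (intro measure_Union_le_pairs) (auto intro: card_ge_0_finite)
  finally have bound: "measure M {\<omega> \<in> space M. weight_error C d (y \<omega>) \<and>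
        hamming_weight (hard_decision (y \<omega>)) \<le> d\<^sub>s}
      \<le> real (A div 2) * ((2 * q - q\<^sup>2) * B2) + (if odd A then q * B1 else 0)"
    by (simp add: \<open>A = card ?W\<close>)
  \<comment> \<open>The halving is absorbed by \<open>2 * q - q\<^sup>2\<close>, which is twice the
    factor in the claim.\<close>
  have "real (A div 2) = (if even A then real A / 2 else (real A - 1) / 2)"
    by (auto elim!: evenE oddE)
  then show ?thesis
    using bound unfolding B by (auto simp: field_simps)
qed

end
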